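(* Let $d\ge 1$ be an integer and let $\rho_{\max}:=\mathbb{I}/d$ be the maximally mixed state on $\mathbb{C}^d$. Then for all $d\times d$ complex Hermitian matrices $A$ and $B$, $$V_{\rho_{\max}}(A)\,V_{\rho_{\max}}(B)\ \ge\ \frac{1}{d^2}\,\bigl\|[A,B]\bigr\|_{\mathrm{op}}^2 .$$
   Context: For a density matrix $\rho$ and a Hermitian matrix $X$, $\langle X\rangle_\rho:=\operatorname{Tr}[X\rho]$ and $V_\rho(X):=\operatorname{Tr}[(X-\langle X\rangle_\rho\mathbb{I})^2\rho]$. $[A,B]:=AB-BA$. $\|X\|_{\mathrm{op}}:=\max_{\psi\ne 0}\|X\psi\|/\|\psi\|$ is the operator norm with respect to the Euclidean norm on $\mathbb{C}^d$. *)

theory Defs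
  imports "HOL-Analysis.Analysis"
begin

definition hermitian :: "complex^'n^'n \<Rightarrow> bool" where
  "hermitian A \<longleftrightarrow> (\<chi> i j. cnj (A $ j $ i)) = A"

text \<open>Expectation and variance are complex-valued, being traces of complex matrices; both are
  real when the state and the observable are Hermitian. Inequalities between them use the library
  order on \<^typ>\<open>complex\<close>: \<open>\<le>\<close> on real parts and equality of imaginary parts. In \<open>mat c\<close> the scalar \<open>c\<close> stands
  for \<open>c\<close> times the identity.\<close>

definition expectation :: "complex^'n^'n \<Rightarrow> complex^'n^'n \<Rightarrow> complex" where
  "expectation \<rho> X = trace (X ** \<rho>)"

definition variance :: "complex^'n^'n \<Rightarrow> complex^'n^'n \<Rightarrow> complex" where
  "variance \<rho> X =
     trace ((X - mat (expectation \<rho> X)) ** (X - mat (expectation \<rho> X)) ** \<rho>)"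

definition commutator :: "complex^'n^'n \<Rightarrow> complex^'n^'n \<Rightarrow> complex^'n^'n" where
  "commutator A B = A ** B - B ** A"

text \<open>The norm of \<^typ>\<open>complex^'n\<close> is the Euclidean one, so \<^const>\<open>onorm\<close> is the supremum of
  \<open>norm (X *v \<psi>) / norm \<psi>\<close>; the vector \<open>\<psi> = 0\<close> contributes only \<open>0 / 0 = 0\<close>.\<close>

definition op_norm :: "complex^'n^'n \<Rightarrow> real" where
  "op_norm X = onorm (\<lambda>\<psi>. X *v \<psi>)"

definition maximally_mixed :: "complex^'n^'n" where
  "maximally_mixed = mat (1 / of_nat CARD('n))"

end

theory Submission
  imports Defs
begin

text \<open>
  For a unit vector \<open>\<psi>\<close> and Hermitian \<open>A\<close>, \<open>B\<close>, remove from \<open>A \<psi>\<close> and \<open>B \<psi>\<close> their components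
  along \<open>\<psi>\<close>, leaving \<open>u\<close> and \<open>v\<close>. Then \<open>\<bar>\<langle>\<psi>, [A, B] \<psi>\<rangle>\<bar> = 2 \<bar>Im \<langle>u, v\<rangle>\<bar> \<le> 2 \<parallel>u\<parallel> \<parallel>v\<parallel>\<close>. In an orthonormal
  basis starting with \<open>\<psi>\<close>, the vector \<open>u\<close> appears twice in a Hermitian matrix, as first column and as
  first row, so \<open>2 \<parallel>u\<parallel>\<^sup>2 \<le> \<parallel>A\<parallel>\<^sup>2\<close> in the Frobenius norm. Since \<open>i [A, B]\<close> is Hermitian, its numerical
  radius is its operator norm, whence \<open>\<parallel>[A, B]\<parallel> \<le> \<parallel>A\<parallel> \<parallel>B\<parallel>\<close> with Frobenius norms on the right. Apply
  this to \<open>A\<close> and \<open>B\<close> shifted by their means: the commutator does not change, and the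
  variances are the squared Frobenius norms divided by \<open>d\<close>.

  The norm of \<^typ>\<open>complex^'n^'n\<close> is the Frobenius norm, and \<open>x \<bullet> y\<close> on \<^typ>\<open>complex^'n\<close> is the real
  part of the Hermitian inner product.
\<close>

text \<open>Polarization: the form \<open>x \<bullet> f x\<close> is compared at
  \<open>x + y\<close> and \<open>x - y\<close>, where \<open>y\<close> is \<open>f x\<close>
  rescaled to the norm of \<open>x\<close>, and the parallelogram law adds up the two
  bounds.\<close>

lemma norm_le_of_numerical_radius_le:
  fixes f :: "'a::real_inner \<Rightarrow> 'a"
  assumes lin: "linear f"
    and sym: "\<And>x y. f x \<bullet> y = x \<bullet> f y"
    and bound: "\<And>x. \<bar>x \<bullet> f x\<bar> \<le> c * (norm x)\<^sup>2"
  shows "norm (f x) \<le> c * norm x"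
proof (cases "f x = 0 \<or> x = 0")
  case True
  have "0 \<le> c * norm x"
  proof (cases "x = 0")
    case False
    have "0 \<le> c * (norm x)\<^sup>2"
      using bound[of x] by linarith
    then show ?thesis
      using False by (simp add: zero_le_mult_iff)
  qed simp
  then show ?thesis
    using True linear_0[OF lin] by auto
next
  case False
  define y where "y = (norm x / norm (f x)) *\<^sub>R f x"
  have ny: "norm y = norm x"
    using False by (simp add: y_def)
  have yfx: "y \<bullet> f x = norm x * norm (f x)"
    using False by (simp add: y_def dot_square_norm power2_eq_square)
  have "4 * (y \<bullet> f x) = (x + y) \<bullet> f (x + y) - (x - y) \<bullet> f (x - y)"
    using sym[of x y]
    by (simp add: linear_add[OF lin] linear_diff[OF lin] inner_simps inner_commute)
  also have "\<dots> \<le> c * (norm (x + y))\<^sup>2 + c * (norm (x - y))\<^sup>2"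
    using bound[of "x + y"] bound[of "x - y"] by linarith
  also have "\<dots> = 4 * (c * (norm x)\<^sup>2)"
  proof -
    have "y \<bullet> y = x \<bullet> x" using ny by (simp add: dot_square_norm)
    then have "(norm (x + y))\<^sup>2 + (norm (x - y))\<^sup>2 = 4 * (norm x)\<^sup>2"
      by (simp add: power2_norm_eq_inner inner_add_left inner_add_right inner_diff_left
          inner_diff_right)
    then show ?thesis
      by (metis distrib_left mult.left_commute)
  qed
  finally have "norm (f x) * norm x \<le> (c * norm x) * norm x"
    by (simp add: yfx power2_eq_square algebra_simps)
  then show ?thesis
    using False by simp
qed

lemma hermitian_cnj: "hermitian A \<Longrightarrow> cnj (A $ i $ j) = A $ j $ i"
  unfolding hermitian_def by (metis vec_lambda_beta)

lemma inner_complex_cnj: "(x::complex) \<bullet> y = Re (x * cnj y)"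
  by (simp add: inner_complex_def)

lemma hermitian_inner:
  assumes "hermitian A"
  shows "(A *v x) \<bullet> y = x \<bullet> (A *v y)"
proof -
  have "(A *v x) \<bullet> y = Re (\<Sum>i\<in>UNIV. \<Sum>j\<in>UNIV. A $ i $ j * x $ j * cnj (y $ i))"
    by (simp add: inner_vec_def matrix_vector_mult_def inner_complex_cnj sum_distrib_right)
  also have "\<dots> = Re (\<Sum>j\<in>UNIV. \<Sum>i\<in>UNIV. A $ i $ j * x $ j * cnj (y $ i))"
    by (subst sum.swap) (rule refl)
  also have "\<dots> = x \<bullet> (A *v y)"
    by (simp add: inner_vec_def matrix_vector_mult_def inner_complex_cnj sum_distrib_left
        hermitian_cnj[OF assms] mult_ac del: times_complex.sel)
  finally show ?thesis .
qed

text \<open>Since \<open>\<bullet>\<close> is only the real part of the Hermitian product, pairing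
  with \<open>\<i> *s y\<close> is the way to reach the imaginary part.\<close>

lemma inner_imaginary_swap: "x \<bullet> (\<i> *s y) = - ((\<i> *s x) \<bullet> (y::complex^'n))"
  by (simp add: inner_vec_def inner_complex_def sum_negf[symmetric])

text \<open>The quadratic form of a Hermitian matrix is real.\<close>

lemma hermitian_inner_imaginary_eq_0:
  assumes "hermitian A"
  shows "(A *v x) \<bullet> (\<i> *s x) = 0"
proof -
  have "(A *v x) \<bullet> (\<i> *s x) = x \<bullet> (\<i> *s (A *v x))"
    by (simp add: hermitian_inner[OF assms] vector_scalar_commute)
  also have "\<dots> = - ((A *v x) \<bullet> (\<i> *s x))"
    by (subst inner_imaginary_swap) (simp only: inner_commute)
  finally show ?thesis by simp
qed

text \<open>The rank-one operator written |x><y| in Dirac notation.\<close>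

definition outer :: "complex^'n \<Rightarrow> complex^'n \<Rightarrow> complex^'n^'n" where
  "outer x y = (\<chi> i j. x $ i * cnj (y $ j))"

lemma inner_outer: "A \<bullet> outer x y = (A *v y) \<bullet> x"
  by (simp add: inner_vec_def outer_def matrix_vector_mult_def inner_complex_cnj
      sum_distrib_left mult_ac del: times_complex.sel)

text \<open>The scalar is the Hermitian product of \<open>y\<close> and \<open>z\<close>,
  conjugate-linear in \<open>y\<close>, assembled from two real inner products.\<close>

lemma outer_mult_vec: "outer x y *v z = Complex (y \<bullet> z) ((\<i> *s y) \<bullet> z) *s x"
proof -
  have "(\<Sum>j\<in>UNIV. cnj (y $ j) * z $ j) = Complex (y \<bullet> z) ((\<i> *s y) \<bullet> z)"
    by (simp add: complex_eq_iff inner_vec_def inner_complex_def)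
  then show ?thesis
    by (simp add: vec_eq_iff outer_def matrix_vector_mult_def mult.assoc
        mult.commute[of _ "x $ i" for i] flip: sum_distrib_left)
qed

lemma norm_hermitian_ge_offdiagonal:
  assumes A: "hermitian A" and \<psi>: "norm \<psi> = 1"
    and u: "u = A *v \<psi> - (\<psi> \<bullet> (A *v \<psi>)) *\<^sub>R \<psi>"
  shows "2 * (norm u)\<^sup>2 \<le> (norm A)\<^sup>2"
proof -
  have \<psi>\<psi>: "\<psi> \<bullet> \<psi> = 1" using \<psi> by (simp add: dot_square_norm)
  have u0: "u \<bullet> \<psi> = 0" by (simp add: u inner_simps \<psi>\<psi> inner_commute)
  have i0: "(\<i> *s x) \<bullet> x = 0" for x :: "complex^'n"
    using inner_imaginary_swap[of x x] by (simp add: inner_commute)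
  \<comment> \<open>With \<open>u0\<close> this makes \<open>u\<close> orthogonal to
    \<open>\<psi>\<close> over the complex numbers, which the vanishing of \<open>cross\<close>
    rests on.\<close>
  have ui: "(\<i> *s u) \<bullet> \<psi> = 0"
    using inner_imaginary_swap[of u \<psi>] hermitian_inner_imaginary_eq_0[OF A, of \<psi>] i0[of \<psi>]
    by (simp add: u inner_simps inner_commute)
  have Au: "(A *v \<psi>) \<bullet> u = (norm u)\<^sup>2"
  proof -
    have "(A *v \<psi>) \<bullet> u = (u + (\<psi> \<bullet> (A *v \<psi>)) *\<^sub>R \<psi>) \<bullet> u" by (simp add: u)
    then show ?thesis using u0 by (simp add: inner_simps inner_commute dot_square_norm)
  qed
  \<comment> \<open>\<open>M\<close> is the part of \<open>A\<close> made of the row and the column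
    holding \<open>u\<close>, written without choosing a basis. As
    \<open>A \<bullet> M = M \<bullet> M\<close>, it is orthogonal to \<open>A - M\<close>, and
    Pythagoras gives the bound.\<close>
  define M where "M = outer \<psi> u + outer u \<psi>"
  have "A \<bullet> M = 2 * (norm u)\<^sup>2"
    using Au hermitian_inner[OF A, of u \<psi>]
    by (simp add: M_def inner_add_right inner_outer inner_commute)
  moreover have "M \<bullet> M = 2 * (norm u)\<^sup>2"
  proof -
    have diag: "outer x y \<bullet> outer x y = (norm x)\<^sup>2 * (norm y)\<^sup>2" for x y :: "complex^'n"
    proof -
      have "Complex (y \<bullet> y) ((\<i> *s y) \<bullet> y) *s x = (y \<bullet> y) *\<^sub>R x"
        by (simp add: i0 vec_eq_iff complex_eq_iff)
      then show ?thesis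
        by (simp only: inner_outer outer_mult_vec inner_scaleR_left power2_norm_eq_inner
            mult.commute)
    qed
    have cross: "outer \<psi> u \<bullet> outer u \<psi> = 0"
      by (simp add: inner_outer outer_mult_vec u0 ui zero_complex.code[symmetric])
    show ?thesis
      using cross
      by (simp add: M_def inner_add_left inner_add_right diag \<psi>
          inner_commute[of "outer u \<psi>" "outer \<psi> u"])
  qed
  moreover have "0 \<le> (A - M) \<bullet> (A - M)" by simp
  ultimately show ?thesis
    by (simp add: inner_diff_left inner_diff_right inner_commute power2_norm_eq_inner)
qed

lemma commutator_mult_vec: "commutator A B *v x = A *v (B *v x) - B *v (A *v x)"
  by (simp add: commutator_def matrix_vector_mult_diff_rdistrib matrix_vector_mul_assoc)

lemma commutator_numerical_radius:
  assumes A: "hermitian A" and B: "hermitian B" and \<psi>: "norm \<psi> = 1"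
  shows "\<bar>\<psi> \<bullet> (\<i> *s (commutator A B *v \<psi>))\<bar> \<le> norm A * norm B"
proof -
  define u where "u = A *v \<psi> - (\<psi> \<bullet> (A *v \<psi>)) *\<^sub>R \<psi>"
  define v where "v = B *v \<psi> - (\<psi> \<bullet> (B *v \<psi>)) *\<^sub>R \<psi>"
  have swap: "x \<bullet> (\<i> *s y) = - (y \<bullet> (\<i> *s x))" for x y :: "complex^'n"
    by (metis inner_imaginary_swap inner_commute)
  have scal: "\<i> *s (r *\<^sub>R x) = r *\<^sub>R (\<i> *s x)" for r and x :: "complex^'n"
    by vector
  have "\<psi> \<bullet> (\<i> *s (commutator A B *v \<psi>)) =
      (A *v \<psi>) \<bullet> (\<i> *s (B *v \<psi>)) - (B *v \<psi>) \<bullet> (\<i> *s (A *v \<psi>))"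
    by (simp add: commutator_mult_vec vector_ssub_ldistrib inner_diff_right
        vector_scalar_commute[symmetric] hermitian_inner[OF A] hermitian_inner[OF B])
  also have "\<dots> = 2 * ((A *v \<psi>) \<bullet> (\<i> *s (B *v \<psi>)))"
    using swap[of "A *v \<psi>" "B *v \<psi>"] by simp
  \<comment> \<open>The removed components are real multiples of \<open>\<psi>\<close>, so every
    term containing them is the imaginary part of a real number.\<close>
  also have "(A *v \<psi>) \<bullet> (\<i> *s (B *v \<psi>)) = u \<bullet> (\<i> *s v)"
    using hermitian_inner_imaginary_eq_0[OF A, of \<psi>] hermitian_inner_imaginary_eq_0[OF B, of \<psi>]
      swap[of \<psi> \<psi>] swap[of \<psi> "B *v \<psi>"]
    by (simp add: u_def v_def inner_simps vector_ssub_ldistrib scal)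
  finally have "\<bar>\<psi> \<bullet> (\<i> *s (commutator A B *v \<psi>))\<bar> \<le> 2 * (norm u * norm v)"
    using Cauchy_Schwarz_ineq2[of u "\<i> *s v"]
    by (simp add: norm_vec_def norm_mult abs_mult)
  also have "\<dots> \<le> norm A * norm B"
  proof (rule power2_le_imp_le)
    show "(2 * (norm u * norm v))\<^sup>2 \<le> (norm A * norm B)\<^sup>2"
      using mult_mono[OF norm_hermitian_ge_offdiagonal[OF A \<psi> u_def]
          norm_hermitian_ge_offdiagonal[OF B \<psi> v_def]]
      by (simp add: power_mult_distrib)
  qed simp
  finally show ?thesis .
qed

lemma op_norm_commutator_le:
  assumes A: "hermitian A" and B: "hermitian B"
  shows "op_norm (commutator A B) \<le> norm A * norm B"
proof -
  \<comment> \<open>The factor \<open>\<i>\<close> makes the skew-Hermitian commutator symmetric and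
    preserves norms.\<close>
  define f where "f x = \<i> *s (commutator A B *v x)" for x
  have sc: "\<i> *s (r *\<^sub>R x) = r *\<^sub>R (\<i> *s x)" for r and x :: "complex^'n"
    by vector
  have lin: "linear f"
    unfolding f_def
    by (rule linearI) (simp_all add: matrix_vector_right_distrib vector_add_ldistrib sc
        linear_scale[OF matrix_vector_mul_linear])
  have sym: "f x \<bullet> y = x \<bullet> f y" for x y
    using inner_imaginary_swap[of x "commutator A B *v y"]
      inner_imaginary_swap[of "commutator A B *v x" y]
    by (simp add: f_def commutator_mult_vec inner_simps vector_ssub_ldistrib
        vector_scalar_commute hermitian_inner[OF A] hermitian_inner[OF B])
  have bound: "\<bar>x \<bullet> f x\<bar> \<le> norm A * norm B * (norm x)\<^sup>2" for x
  proof (cases "x = 0")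
    case False
    define \<psi> where "\<psi> = x /\<^sub>R norm x"
    have \<psi>: "norm \<psi> = 1" and x: "x = norm x *\<^sub>R \<psi>"
      using False by (simp_all add: \<psi>_def)
    have "x \<bullet> f x = (norm x)\<^sup>2 * (\<psi> \<bullet> f \<psi>)"
      by (subst (1 2) x) (simp add: linear_scale[OF lin] power2_eq_square)
    then show ?thesis
      using commutator_numerical_radius[OF A B \<psi>]
      by (simp add: f_def abs_mult mult.commute[of _ "(norm x)\<^sup>2"] mult_left_mono)
  qed simp
  show ?thesis
    unfolding op_norm_def
  proof (rule onorm_bound)
    fix x
    have "norm (commutator A B *v x) = norm (f x)"
      by (simp add: f_def norm_vec_def norm_mult)
    then show "norm (commutator A B *v x) \<le> norm A * norm B * norm x"
      using norm_le_of_numerical_radius_le[OF lin sym bound] by simp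
  qed simp
qed

lemma trace_hermitian_square:
  assumes "hermitian A"
  shows "trace (A ** A) = complex_of_real ((norm A)\<^sup>2)"
proof -
  have "A $ i $ j * A $ j $ i = complex_of_real ((cmod (A $ i $ j))\<^sup>2)" for i j
    by (metis hermitian_cnj[OF assms] complex_norm_square)
  moreover have "(norm A)\<^sup>2 = (\<Sum>i\<in>UNIV. \<Sum>j\<in>UNIV. (cmod (A $ i $ j))\<^sup>2)"
    by (simp add: power2_norm_eq_inner inner_vec_def)
  ultimately show ?thesis
    by (simp add: trace_def matrix_matrix_mult_def)
qed

lemma trace_mult_mat: "trace (X ** mat c) = trace X * c"
  by (simp add: trace_def matrix_matrix_mult_def mat_def if_distrib cong: if_cong)
     (simp add: sum_distrib_right)

text \<open>The mean is a real multiple of the trace, whose summands are real diagonal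
  entries.\<close>

lemma hermitian_shift:
  assumes A: "hermitian A"
  shows "hermitian (A - mat (expectation maximally_mixed A))"
proof -
  have "cnj (expectation maximally_mixed A) = expectation maximally_mixed A"
    by (simp add: expectation_def maximally_mixed_def trace_mult_mat)
       (simp add: trace_def cnj_sum hermitian_cnj[OF A])
  then show ?thesis
    by (auto simp: hermitian_def vec_eq_iff mat_def hermitian_cnj[OF A])
qed

lemma variance_maximally_mixed:
  fixes A :: "complex^'n^'n"
  assumes "hermitian A"
  shows "variance maximally_mixed A =
    complex_of_real ((norm (A - mat (expectation maximally_mixed A)))\<^sup>2 / real CARD('n))"
  using trace_hermitian_square[OF hermitian_shift[OF assms]]
  by (simp add: variance_def) (simp add: maximally_mixed_def trace_mult_mat)

lemma commutator_shift:
  fixes A B :: "complex^'n^'n"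
  shows "commutator (A - mat a) (B - mat b) = commutator A B"
proof -
  have "mat c *v x = c *s x" for c and x :: "complex^'n"
    by (vector matrix_vector_mult_def mat_def)
       (simp add: if_distrib[of "\<lambda>a. a * _"] cong: if_cong)
  then show ?thesis
    by (simp add: matrix_eq commutator_mult_vec matrix_vector_mult_diff_rdistrib
        matrix_vector_mult_diff_distrib vector_ssub_ldistrib vector_scalar_commute
        vector_smult_assoc mult.commute)
qed

theorem mainTheorem3:
  fixes A B :: "complex^'n^'n"
  assumes "hermitian A" and "hermitian B"
  shows "variance maximally_mixed A * variance maximally_mixed B
    \<ge> complex_of_real (1 / (real CARD('n))\<^sup>2 * (op_norm (commutator A B))\<^sup>2)"
proof -
  define A' where "A' = A - mat (expectation maximally_mixed A)"
  define B' where "B' = B - mat (expectation maximally_mixed B)"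
  have "op_norm (commutator A B) \<le> norm A' * norm B'"
    using op_norm_commutator_le[OF hermitian_shift[OF assms(1)] hermitian_shift[OF assms(2)]]
    by (simp add: commutator_shift A'_def B'_def)
  moreover have "0 \<le> op_norm (commutator A B)"
    unfolding op_norm_def by (rule onorm_pos_le) simp
  ultimately have "(op_norm (commutator A B))\<^sup>2 \<le> (norm A')\<^sup>2 * (norm B')\<^sup>2"
    by (metis power_mono power_mult_distrib)
  then have "1 / (real CARD('n))\<^sup>2 * (op_norm (commutator A B))\<^sup>2
      \<le> (norm A')\<^sup>2 / real CARD('n) * ((norm B')\<^sup>2 / real CARD('n))"
    by (simp add: power2_eq_square divide_right_mono)
  then show ?thesis
    unfolding variance_maximally_mixed[OF assms(1)] variance_maximally_mixed[OF assms(2)]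
    unfolding of_real_mult[symmetric] A'_def[symmetric] B'_def[symmetric]
    by (simp add: less_eq_complex_def)
qed

end
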